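(* Let $P$ be a plane tree with an even number $n$ of vertices. Then the parity of the pr-tree obtained from $P$ by choosing a root vertex (and a marked edge at it) does not depend on the choice of the root vertex: any two pr-trees obtained from $P$ in this way are both even or both odd.
   Context: A plane tree is a finite tree embedded in the plane (equivalently, a tree with a cyclic counterclockwise order on the edges at each vertex). A pr-tree (plane rooted tree) is obtained from a plane tree by choosing a root vertex and a marked edge incident to the root. It is drawn growing downwards from the root with the marked edge leftmost; the children of each vertex are then ordered from left to right: at the root, the edges are taken in counterclockwise order starting from the marked edge, and at any other vertex the edges to children are taken in counterclockwise order starting just after the edge to the parent. (For a fixed root, the parity defined below does not depend on the choice of the marked edge.) Bracket code: walk around the tree starting at the root, visiting the children of each vertex from left to right (depth-first); write an opening bracket when a vertex is met for the first time and a closing bracket when it is met for the last time. Thus, recursively, the code of a pr-tree whose root has pr-subtrees $T_1,\dots,T_s$ (left to right) is $(\,c(T_1)\cdots c(T_s)\,)$, and the one-vertex tree has code $()$. An inversion in a bracket code is a pair consisting of a closing bracket and an opening bracket, not necessarily adjacent, such that the closing bracket occurs before the opening bracket. A pr-tree is even if the number of inversions in its bracket code is even, and odd otherwise; this is its parity. *)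

theory Defs
  imports "Graph_Theory.Graph_Theory" "HOL-Combinatorics.Orbits"
begin

section \<open>Plane trees\<close>

definition nbrs :: "'a pair_pre_digraph \<Rightarrow> 'a \<Rightarrow> 'a set" where
  "nbrs G v = {w. (v, w) \<in> parcs G}"

text \<open>
  A \<^locale>\<open>pair_graph\<close> is a finite simple undirected graph in which every edge is represented by its
  two opposite arcs. The constant \<^const>\<open>tree\<close> of the graph library is unsuitable here:
  its \<^const>\<open>forest\<close> forbids all directed cycles, and the two arcs of a single
  edge already form one, of length 2. Cycles of the undirected graph are exactly the directed
  cycles of length at least 3.

  As the graph is simple, the edges at a vertex \<open>v\<close> are identified with the neighbours of \<open>v\<close>; the
  edge following the one to \<open>w\<close> in counterclockwise order around \<open>v\<close> is the one to \<open>rot v w\<close>.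
\<close>

locale plane_tree = pair_graph G for G :: "'a pair_pre_digraph" +
  fixes rot :: "'a \<Rightarrow> 'a \<Rightarrow> 'a"
  assumes connected: "connected (with_proj G)"
    and acyclic: "cycle p \<Longrightarrow> length p \<le> 2"
    and rot_cyclic: "\<lbrakk>v \<in> pverts G; nbrs G v \<noteq> {}\<rbrakk> \<Longrightarrow> cyclic_on (rot v) (nbrs G v)"


section \<open>Pr-trees, bracket codes and parity\<close>

datatype prtree = Node "prtree list"

datatype bracket = Opening | Closing

fun code :: "prtree \<Rightarrow> bracket list" where
  "code (Node ts) = Opening # concat (map code ts) @ [Closing]"

definition inversions :: "bracket list \<Rightarrow> (nat \<times> nat) set" where
  "inversions w = {(i, j). i < j \<and> j < length w \<and> w ! i = Closing \<and> w ! j = Opening}"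

definition even_prtree :: "prtree \<Rightarrow> bool" where
  "even_prtree t \<longleftrightarrow> even (card (inversions (code t)))"


section \<open>The pr-trees obtained from a plane tree\<close>

text \<open>
  \<open>branch G rot u v t\<close>: the vertex \<open>v\<close> with parent \<open>u\<close>, together with all its descendants, is drawn
  as \<open>t\<close>. The children of \<open>v\<close> are all its neighbours except \<open>u\<close>, in counterclockwise order
  starting just after \<open>u\<close>.
\<close>

inductive branch :: "'a pair_pre_digraph \<Rightarrow> ('a \<Rightarrow> 'a \<Rightarrow> 'a) \<Rightarrow> 'a \<Rightarrow> 'a \<Rightarrow> prtree \<Rightarrow> bool"
  for G rot where
  "list_all2 (branch G rot v) (map (\<lambda>i. (rot v ^^ i) u) [1..<card (nbrs G v)]) ts
    \<Longrightarrow> branch G rot u v (Node ts)"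

text \<open>
  \<open>pr_tree_of G rot r m t\<close>: choosing the root \<open>r\<close> and the marked edge from \<open>r\<close> to \<open>m\<close> yields the
  pr-tree \<open>t\<close>. Here the children are all neighbours of \<open>r\<close>, starting with \<open>m\<close>.
\<close>

definition pr_tree_of ::
  "'a pair_pre_digraph \<Rightarrow> ('a \<Rightarrow> 'a \<Rightarrow> 'a) \<Rightarrow> 'a \<Rightarrow> 'a \<Rightarrow> prtree \<Rightarrow> bool" where
  "pr_tree_of G rot r m t \<longleftrightarrow> (r, m) \<in> parcs G \<and>
    (\<exists>ts. t = Node ts \<and>
      list_all2 (branch G rot r) (map (\<lambda>i. (rot r ^^ i) m) [0..<card (nbrs G r)]) ts)"


subsection \<open>Every root and marked edge yield exactly one pr-tree\<close>

lemma cyclic_funpow_neq: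
  assumes "cyclic_on f S" "x \<in> S" "0 < i" "i < card S"
  shows "(f ^^ i) x \<noteq> x"
proof
  assume "(f ^^ i) x = x"
  then have "orbit f x = {(f ^^ m) x | m. m < i}"
    using assms(3) by (rule orbit_altdef_bounded)
  also have "\<dots> = (\<lambda>m. (f ^^ m) x) ` {..<i}" by auto
  finally have "card S \<le> i"
    using orbit_cyclic_eq3[OF assms(1,2)] card_image_le[of "{..<i}" "\<lambda>m. (f ^^ m) x"] by simp
  with assms(4) show False by simp
qed

context plane_tree
begin

lemma nonbacktracking_distinct:
  assumes "awalk u p v" "successively (\<lambda>a b. snd b \<noteq> fst a) p"
  shows "distinct (pawalk_verts u p)"
  using assms
proof (induction p arbitrary: u)
  case (Cons e es)
  have e: "e \<in> parcs G" "u = fst e" and es: "awalk (snd e) es v"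
    using Cons.prems(1) by (auto simp: awalk_Cons_iff)
  have succ: "successively (\<lambda>a b. snd b \<noteq> fst a) es"
    using Cons.prems(2) by (auto simp: successively_Cons)
  have dist: "distinct (pawalk_verts (snd e) es)"
    using Cons.IH[OF es succ] .
  have "u \<notin> set (pawalk_verts (snd e) es)"
  proof
    assume "u \<in> set (pawalk_verts (snd e) es)"
    then obtain q r where qr: "es = q @ r" "awalk (snd e) q u" "awalk u r v"
      using awalk_decomp[OF es] by blast
    have "distinct (pawalk_verts (snd e) q)"
      using dist qr by (auto simp: awalk_verts_append)
    moreover have "awalk u (e # q) u"
      using e qr(2) by (auto simp: awalk_Cons_iff)
    ultimately have "cycle (e # q)"
      unfolding cycle_def using e by auto
    then have "length (e # q) \<le> 2"
      by (rule acyclic)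
    then consider "q = []" | f where "q = [f]"
      by (cases q) auto
    then show False
    proof cases
      case 1
      with qr(2) e show False
        using no_loops[of e] by (auto simp: awalk_Nil_iff)
    next
      case 2
      then have "snd f = u"
        using qr(2) by (auto simp: awalk_Cons_iff awalk_Nil_iff)
      then show False
        using Cons.prems(2) qr(1) 2 e by (auto simp: successively_Cons)
    qed
  qed
  with dist e show ?case by simp
qed (simp add: awalk_Nil_iff)

definition below :: "(('a \<times> 'a) \<times> ('a \<times> 'a)) set" where
  "below = {((v, w), (u, v')) | u v v' w. v = v' \<and> (u, v) \<in> parcs G \<and> (v, w) \<in> parcs G \<and> w \<noteq> u}"

lemma below_walk:
  assumes "(b, a) \<in> below\<^sup>+"
  shows "\<exists>p. awalk (fst a) (a # p @ [b]) (snd b)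
    \<and> successively (\<lambda>a b. snd b \<noteq> fst a) (a # p @ [b])"
  using assms
proof (induction rule: converse_trancl_induct)
  case (base b)
  then have "awalk (fst a) (a # [] @ [b]) (snd b)
    \<and> successively (\<lambda>a b. snd b \<noteq> fst a) (a # [] @ [b])"
    by (auto simp: below_def awalk_Cons_iff awalk_Nil_iff dest: in_arcsD1 in_arcsD2)
  then show ?case by blast
next
  case (step c b)
  then obtain p where p: "awalk (fst a) (a # p @ [b]) (snd b)"
    "successively (\<lambda>a b. snd b \<noteq> fst a) (a # p @ [b])" by blast
  have c: "c \<in> parcs G" "fst c = snd b" "snd c \<noteq> fst b"
    using step.hyps(1) by (auto simp: below_def)
  have "awalk (fst c) [c] (snd c)"
    using arc_implies_awalk[OF c(1)] .
  then have "awalk (fst a) ((a # p @ [b]) @ [c]) (snd c)"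
    using p(1) c(2) awalk_appendI by metis
  moreover have "successively (\<lambda>a b. snd b \<noteq> fst a) ((a # p @ [b]) @ [c])"
    using p(2) c(3) by (subst successively_append_iff) auto
  ultimately have "awalk (fst a) (a # (p @ [b]) @ [c]) (snd c)
    \<and> successively (\<lambda>a b. snd b \<noteq> fst a) (a # (p @ [b]) @ [c])"
    by (simp del: successively.simps)
  then show ?case by blast
qed

lemma wf_below: "wf below"
proof (rule finite_acyclic_wf)
  have "below \<subseteq> parcs G \<times> parcs G"
    by (auto simp: below_def)
  then show "finite below"
    by (rule finite_subset) simp
  show "Transitive_Closure.acyclic below"
  proof (rule acyclicI, rule allI, rule notI)
    fix a assume "(a, a) \<in> below\<^sup>+"
    then obtain p where p: "awalk (fst a) (a # p @ [a]) (snd a)"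
      "successively (\<lambda>a b. snd b \<noteq> fst a) (a # p @ [a])"
      using below_walk by blast
    then have "distinct (pawalk_verts (fst a) (a # p @ [a]))"
      by (rule nonbacktracking_distinct)
    moreover have "fst a \<in> set (pawalk_verts x (p @ [a]))" for x
      by (induction p arbitrary: x) auto
    ultimately show False by simp
  qed
qed

lemma rot_funpow_nbrs:
  assumes "(v, u) \<in> parcs G"
  shows "(v, (rot v ^^ i) u) \<in> parcs G"
    and "\<lbrakk>0 < i; i < card (nbrs G v)\<rbrakk> \<Longrightarrow> (rot v ^^ i) u \<noteq> u"
proof -
  have u: "u \<in> nbrs G v"
    using assms by (simp add: nbrs_def)
  then have cyc: "cyclic_on (rot v) (nbrs G v)"
    using rot_cyclic assms in_arcsD1 by blast
  show "(v, (rot v ^^ i) u) \<in> parcs G"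
    using cyclic_on_funpow_in[OF cyc u] by (simp add: nbrs_def)
  show "\<lbrakk>0 < i; i < card (nbrs G v)\<rbrakk> \<Longrightarrow> (rot v ^^ i) u \<noteq> u"
    using cyclic_funpow_neq[OF cyc u] by blast
qed

lemma list_all2_ex1:
  assumes "\<And>x. x \<in> set xs \<Longrightarrow> \<exists>!y. P x y"
  shows "\<exists>!ys. list_all2 P xs ys"
  using assms
proof (induction xs)
  case (Cons x xs)
  have 1: "\<exists>!y. P x y" "\<exists>!ys. list_all2 P xs ys"
    using Cons by auto
  then obtain y ys where "P x y" "list_all2 P xs ys" by blast
  with 1 show ?case
    by (intro ex1I[of _ "y # ys"]) (auto simp: list_all2_Cons1)
qed auto

lemma branch_ex1:
  assumes "(u, v) \<in> parcs G"
  shows "\<exists>!t. branch G rot u v t"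
proof -
  have "\<lbrakk>a = (u, v); (u, v) \<in> parcs G\<rbrakk> \<Longrightarrow> \<exists>!t. branch G rot u v t" for a u v
  proof (induction a arbitrary: u v rule: wf_induct_rule[OF wf_below])
    case (1 a)
    have vu: "(v, u) \<in> parcs G"
      using arcs_symmetric 1 by blast
    let ?ws = "map (\<lambda>i. (rot v ^^ i) u) [1..<card (nbrs G v)]"
    have "\<exists>!t. branch G rot v w t" if "w \<in> set ?ws" for w
    proof -
      have "(v, w) \<in> parcs G" "w \<noteq> u"
        using that rot_funpow_nbrs[OF vu] by auto
      then show ?thesis
        using 1 by (auto simp: below_def)
    qed
    then have "\<exists>!ts. list_all2 (branch G rot v) ?ws ts"
      by (rule list_all2_ex1)
    then show ?case
      by (auto simp: branch.simps[of G rot u v])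
  qed
  then show ?thesis using assms by blast
qed

theorem pr_tree_of_ex1:
  assumes "(r, m) \<in> parcs G"
  shows "\<exists>!t. pr_tree_of G rot r m t"
proof -
  have "\<exists>!ts. list_all2 (branch G rot r) (map (\<lambda>i. (rot r ^^ i) m) [0..<card (nbrs G r)]) ts"
    using rot_funpow_nbrs(1)[OF assms] by (intro list_all2_ex1 branch_ex1) auto
  then show ?thesis
    using assms by (auto simp: pr_tree_of_def)
qed

end

end

theory Submission
  imports Defs
begin

text \<open>
  For bracket words \<open>v\<close> and \<open>w\<close>, the inversions of \<open>v w\<close> are those of \<open>v\<close>, those of \<open>w\<close>, and one
  for each closing bracket of \<open>v\<close> and opening bracket of \<open>w\<close>. As codes are balanced, the number of
  inversions is unchanged when the children of the root are rotated, so the marked edge is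
  irrelevant. Let \<open>S\<close> and \<open>T\<close> be the forests, with \<open>s\<close> and \<open>t\<close> vertices, that remain when two adjacent
  vertices are deleted. Choosing one or the other of these as the root gives the codes \<open>((S)T)\<close> and
  \<open>((T)S)\<close>, whose numbers of inversions differ by \<open>(s + 1)t - (t + 1)s = t - s\<close>. This is even as
  \<open>s + t + 2\<close> is the number of vertices. Any two roots are joined by a walk.
\<close>

section \<open>Inversions\<close>

lemma finite_inversions [simp]: "finite (inversions w)"
  by (rule finite_subset[of _ "{..<length w} \<times> {..<length w}"]) (auto simp: inversions_def)

lemma card_inversions_Nil [simp]: "card (inversions []) = 0"
  by (simp add: inversions_def)

lemma card_nth_eq_count_list: "card {j. j < length w \<and> w ! j = a} = count_list w a"
  by (simp add: count_list_eq_length_filter length_filter_conv_card eq_commute)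

text \<open>The leading bracket can only be the left member of an inversion; if it is closing, it
  pairs with every opening bracket of \<open>w\<close>. All other inversions are those of
  \<open>w\<close>, shifted by one position.\<close>

lemma card_inversions_Cons [simp]:
  "card (inversions (x # w)) =
    card (inversions w) + (if x = Closing then count_list w Opening else 0)"
proof -
  let ?A = "map_prod Suc Suc ` inversions w"
  let ?J = "{j. j < length w \<and> w ! j = Opening}"
  let ?B = "if x = Closing then (\<lambda>j. (0, Suc j)) ` ?J else {}"
  have "inversions (x # w) = ?A \<union> ?B"
  proof (rule set_eqI, safe)
    fix i j assume "(i, j) \<in> inversions (x # w)" "(i, j) \<notin> ?B"
    then show "(i, j) \<in> ?A"
      by (cases i; cases j) (auto simp: inversions_def image_iff split: if_splits)
  qed (auto simp: inversions_def split: if_splits)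
  moreover have "card ?A = card (inversions w)"
    by (intro card_image) (auto simp: inj_on_def)
  moreover have "card ((\<lambda>j. (0::nat, Suc j)) ` ?J) = count_list w Opening"
    by (subst card_image) (auto simp: inj_on_def card_nth_eq_count_list)
  moreover have "?A \<inter> ?B = {}"
    by auto
  ultimately show ?thesis
    by (auto simp: card_Un_disjoint)
qed

lemma card_inversions_append [simp]:
  "card (inversions (v @ w)) =
    card (inversions v) + card (inversions w) + count_list v Closing * count_list w Opening"
  by (induction v) auto

lemma count_list_code: "count_list (code t) Closing = count_list (code t) Opening"
proof (induction t rule: code.induct)
  case (1 ts)
  then have "count_list (concat (map code ts)) Closing = count_list (concat (map code ts)) Opening"
    by (induction ts) auto
  then show ?case by simp
qed

lemma count_list_codes:
  "count_list (concat (map code ts)) Closing = count_list (concat (map code ts)) Opening"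
  by (induction ts) (auto simp: count_list_code)

text \<open>Each vertex writes exactly one opening bracket, so this is the number of
  vertices.\<close>

definition order :: "prtree \<Rightarrow> nat" where
  "order t = count_list (code t) Opening"

lemma order_Node [simp]: "order (Node ts) = Suc (sum_list (map order ts))"
proof -
  have "count_list (concat (map code ts)) Opening = sum_list (map order ts)"
    by (induction ts) (auto simp: order_def)
  then show ?thesis by (simp add: order_def)
qed

text \<open>The root's brackets come first and last and take part in no inversion. If
  \<open>ts\<close> has k vertices and \<open>t\<close> has l, balancedness makes the mixed term k *
  l in either order.\<close>

lemma even_prtree_rotate: "even_prtree (Node (ts @ [t])) \<longleftrightarrow> even_prtree (Node (t # ts))"
  by (simp add: even_prtree_def count_list_code count_list_codes ac_simps)

text \<open>The two trees arise from one plane tree by rooting it at either end of an edge that is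
  marked from both sides. The assumption says that \<open>ss\<close> and \<open>ts\<close> have
  vertex counts of equal parity.\<close>

lemma even_prtree_shift_root:
  assumes "even (order (Node (Node ss # ts)))"
  shows "even_prtree (Node (Node ss # ts)) \<longleftrightarrow> even_prtree (Node (Node ts # ss))"
  using assms by (auto simp: even_prtree_def order_def count_list_codes)


section \<open>Rotations around a vertex\<close>

context plane_tree
begin

lemma rot_enum:
  assumes "(v, u) \<in> parcs G"
  shows "distinct (map (\<lambda>i. (rot v ^^ i) u) [0..<card (nbrs G v)])" (is ?dist)
    and "set (map (\<lambda>i. (rot v ^^ i) u) [0..<card (nbrs G v)]) = nbrs G v" (is ?set)
    and "(rot v ^^ card (nbrs G v)) u = u" (is ?per)
    and "card (nbrs G v) > 0"
proof -
  let ?d = "card (nbrs G v)"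
  \<comment> \<open>The starting index is arbitrary, so that this serves both injectivity on the
    first \<open>?d\<close> indices and the exclusion of wrong return points for the
    \<open>?d\<close>-th iterate.\<close>
  have neq: "(rot v ^^ i) u \<noteq> (rot v ^^ j) u" if "i < j" "j < i + ?d" for i j
  proof -
    have "(rot v ^^ (j - i)) ((rot v ^^ i) u) \<noteq> (rot v ^^ i) u"
      using that rot_funpow_nbrs(1)[OF assms] by (intro rot_funpow_nbrs(2)) auto
    moreover have "(rot v ^^ (j - i)) ((rot v ^^ i) u) = (rot v ^^ j) u"
      using that funpow_add[of "j - i" i "rot v"] by simp
    ultimately show ?thesis by simp
  qed
  have fin: "finite (nbrs G v)"
    by (rule finite_subset[of _ "snd ` parcs G"]) (force simp: nbrs_def)+
  then show "?d > 0"
    using assms by (auto simp: card_gt_0_iff nbrs_def)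
  have inj: "inj_on (\<lambda>i. (rot v ^^ i) u) {0..<?d}"
    by (intro linorder_inj_onI) (auto dest: neq)
  then show ?dist
    by (simp add: distinct_map)
  have "(\<lambda>i. (rot v ^^ i) u) ` {0..<?d} \<subseteq> nbrs G v"
    using rot_funpow_nbrs(1)[OF assms] by (auto simp: nbrs_def)
  then have "(\<lambda>i. (rot v ^^ i) u) ` {0..<?d} = nbrs G v"
    using fin by (intro card_subset_eq) (simp_all add: card_image[OF inj])
  then show ?set by simp
  \<comment> \<open>The first \<open>?d\<close> iterates exhaust the neighbours, so the next one
    repeats one of them; \<open>neq\<close> rules out every index but 0.\<close>
  then have "(rot v ^^ ?d) u \<in> (\<lambda>i. (rot v ^^ i) u) ` {0..<?d}"
    using rot_funpow_nbrs(1)[OF assms] by (simp add: nbrs_def)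
  then obtain i where i: "i < ?d" "(rot v ^^ i) u = (rot v ^^ ?d) u" by auto
  then show ?per
    using neq[of i ?d] by (cases "i = 0") auto
qed

text \<open>The tail is exactly the child list that \<open>branch\<close> uses at \<open>v\<close>
  with parent \<open>u\<close>. Hence marking the edge to \<open>u\<close> leaves, after the
  leftmost child, the children \<open>v\<close> would have below \<open>u\<close>.\<close>

lemma rot_enum_Cons:
  assumes "(v, u) \<in> parcs G"
  shows "map (\<lambda>i. (rot v ^^ i) u) [0..<card (nbrs G v)] =
    u # map (\<lambda>i. (rot v ^^ i) u) [1..<card (nbrs G v)]"
  using rot_enum(4)[OF assms] by (simp add: upt_conv_Cons)

text \<open>Starting one edge later raises every index by one; the last index becomes the degree,
  where the iteration returns to \<open>u\<close>.\<close>

lemma rot_enum_rotate: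
  assumes "(v, u) \<in> parcs G"
  shows "map (\<lambda>i. (rot v ^^ i) (rot v u)) [0..<card (nbrs G v)] =
    map (\<lambda>i. (rot v ^^ i) u) [1..<card (nbrs G v)] @ [u]"
proof -
  obtain k where k: "card (nbrs G v) = Suc k"
    using rot_enum(4)[OF assms] by (cases "card (nbrs G v)") auto
  have "map (\<lambda>i. (rot v ^^ i) (rot v u)) [0..<Suc k] = map (\<lambda>i. (rot v ^^ Suc i) u) [0..<Suc k]"
    by (simp add: funpow_swap1)
  also have "\<dots> = map (\<lambda>i. (rot v ^^ i) u) (map Suc [0..<Suc k])"
    unfolding map_map comp_def ..
  also have "\<dots> = map (\<lambda>i. (rot v ^^ i) u) [1..<Suc k] @ [(rot v ^^ Suc k) u]"
    unfolding map_Suc_upt by simp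
  finally show ?thesis
    using rot_enum(3)[OF assms] unfolding k by simp
qed

text \<open>Advancing the mark by one edge sends the leftmost subtree to the far right; uniqueness
  of the pr-tree identifies \<open>t'\<close> with the result.\<close>

lemma even_prtree_rot:
  assumes "pr_tree_of G rot r m t" "pr_tree_of G rot r (rot r m) t'"
  shows "even_prtree t \<longleftrightarrow> even_prtree t'"
proof -
  have rm: "(r, m) \<in> parcs G"
    using assms(1) by (simp add: pr_tree_of_def)
  obtain a ts where t: "t = Node (a # ts)" and a: "branch G rot r m a"
    and ts: "list_all2 (branch G rot r) (map (\<lambda>i. (rot r ^^ i) m) [1..<card (nbrs G r)]) ts"
    using assms(1) unfolding pr_tree_of_def rot_enum_Cons[OF rm] by (auto simp: list_all2_Cons1)
  have "pr_tree_of G rot r (rot r m) (Node (ts @ [a]))"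
    unfolding pr_tree_of_def rot_enum_rotate[OF rm]
    using a ts rot_funpow_nbrs(1)[OF rm, of 1] by (auto intro: list_all2_appendI)
  then have "t' = Node (ts @ [a])"
    using assms(2) pr_tree_of_ex1[of r "rot r m"] rot_funpow_nbrs(1)[OF rm, of 1] by auto
  then show ?thesis
    by (simp add: t even_prtree_rotate)
qed

lemma even_prtree_marked_edge:
  assumes "pr_tree_of G rot r m t" "pr_tree_of G rot r m' t'"
  shows "even_prtree t \<longleftrightarrow> even_prtree t'"
proof -
  have rm: "(r, m) \<in> parcs G" "(r, m') \<in> parcs G"
    using assms by (simp_all add: pr_tree_of_def)
  have "even_prtree t \<longleftrightarrow> even_prtree s" if "pr_tree_of G rot r ((rot r ^^ i) m) s" for i s
    using that
  proof (induction i arbitrary: s)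
    case 0
    then show ?case
      using assms(1) pr_tree_of_ex1[OF rm(1)] by auto
  next
    case (Suc i)
    obtain s' where "pr_tree_of G rot r ((rot r ^^ i) m) s'"
      using pr_tree_of_ex1[OF rot_funpow_nbrs(1)[OF rm(1)]] by blast
    with Suc show ?case
      using even_prtree_rot by simp
  qed
  \<comment> \<open>The rotation is cyclic on the neighbours, so every other mark is an iterate of
    the given one.\<close>
  moreover have "m' \<in> set (map (\<lambda>i. (rot r ^^ i) m) [0..<card (nbrs G r)])"
    unfolding rot_enum(2)[OF rm(1)] using rm by (simp add: nbrs_def)
  then obtain i where "m' = (rot r ^^ i) m"
    by auto
  ultimately show ?thesis
    using assms(2) by blast
qed


section \<open>The number of vertices\<close>

text \<open>Walks in which no arc is followed by its reverse. In a tree these are the paths, but the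
  condition is local, hence easy to check when walks are reversed, extended or joined.\<close>

definition nb_walk :: "'a \<Rightarrow> ('a \<times> 'a) list \<Rightarrow> 'a \<Rightarrow> bool" where
  "nb_walk u p v \<longleftrightarrow> awalk u p v \<and> successively (\<lambda>a b. snd b \<noteq> fst a) p"

text \<open>A nonempty closed walk visits \<open>u\<close> at both ends, whereas acyclicity keeps a
  non-backtracking walk from repeating a vertex.\<close>

lemma nb_walk_closed: "nb_walk u p u \<longleftrightarrow> p = [] \<and> u \<in> pverts G"
proof
  assume *: "nb_walk u p u"
  then have "distinct (pawalk_verts u p)"
    unfolding nb_walk_def by (blast intro: nonbacktracking_distinct)
  moreover have "awalk u p u"
    using * by (simp add: nb_walk_def)
  moreover from this have "last (pawalk_verts u p) = u" "u \<in> pverts G"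
    by auto
  ultimately show "p = [] \<and> u \<in> pverts G"
    by (cases p) (auto split: if_splits)
qed (simp add: nb_walk_def awalk_Nil_iff)

lemma nb_walk_rev:
  assumes "nb_walk u p v"
  shows "nb_walk v (rev (map prod.swap p)) u"
proof -
  have "awalk u p v \<Longrightarrow> awalk v (rev (map prod.swap p)) u"
  proof (induction p arbitrary: u)
    case (Cons e p)
    then have "awalk v (rev (map prod.swap p)) (snd e)" "e \<in> parcs G" "u = fst e"
      by (auto simp: awalk_Cons_iff)
    moreover from this have "awalk (snd e) [prod.swap e] u"
      using arc_implies_awalk[of "prod.swap e"] arcs_symmetric[of "fst e" "snd e"]
      by (simp add: prod.swap_def)
    ultimately show ?case
      by (simp del: awalk_append_iff) (rule awalk_appendI)
  qed (simp add: awalk_Nil_iff)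
  then show ?thesis
    using assms by (auto simp: nb_walk_def successively_rev successively_map
      elim: successively_mono)
qed

text \<open>For an arc from \<open>u\<close> to \<open>v\<close>, this is \<open>v\<close> with all
  its descendants when \<open>u\<close> is its parent.\<close>

definition branch_verts :: "'a \<Rightarrow> 'a \<Rightarrow> 'a set" where
  "branch_verts u v = {x. \<exists>p. nb_walk u ((u, v) # p) x}"

lemma branch_verts_subset: "branch_verts u v \<subseteq> pverts G"
  by (auto simp: branch_verts_def nb_walk_def)

lemma finite_branch_verts [simp]: "finite (branch_verts u v)"
  using branch_verts_subset by (rule finite_subset) simp

lemma root_notin_branch_verts: "u \<notin> branch_verts u v"
  by (auto simp: branch_verts_def nb_walk_closed)

text \<open>From a common vertex \<open>x\<close>, one walk reversed and then the other form a
  nonempty closed walk. It does not backtrack at \<open>v\<close> because \<open>w\<close> and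
  \<open>w'\<close> differ, contradicting \<open>nb_walk_closed\<close>.\<close>

lemma branch_verts_disjoint:
  assumes "w \<noteq> w'"
  shows "branch_verts v w \<inter> branch_verts v w' = {}"
proof (rule equals0I)
  fix x assume "x \<in> branch_verts v w \<inter> branch_verts v w'"
  then obtain p q where p: "nb_walk v ((v, w) # p) x" and q: "nb_walk v ((v, w') # q) x"
    by (auto simp: branch_verts_def)
  have "awalk x (rev (map prod.swap ((v, w) # p)) @ (v, w') # q) x"
    using nb_walk_rev[OF p] q unfolding nb_walk_def by (blast intro: awalk_appendI)
  then have "nb_walk x (rev (map prod.swap ((v, w) # p)) @ (v, w') # q) x"
    using nb_walk_rev[OF p] q assms unfolding nb_walk_def
    by (auto simp: successively_append_iff simp del: awalk_append_iff)
  then show False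
    by (simp add: nb_walk_closed)
qed

text \<open>Walks are split by their second arc, from \<open>v\<close> to some \<open>w\<close>; not
  backtracking means that \<open>w\<close> is not \<open>u\<close>.\<close>

lemma branch_verts_rec:
  assumes "(u, v) \<in> parcs G"
  shows "branch_verts u v = insert v (\<Union>w \<in> nbrs G v - {u}. branch_verts v w)"
proof -
  have "x \<in> branch_verts u v \<longleftrightarrow> x = v \<or> (\<exists>w \<in> nbrs G v - {u}. x \<in> branch_verts v w)" for x
  proof
    assume "x \<in> branch_verts u v"
    then obtain p where p: "nb_walk u ((u, v) # p) x"
      by (auto simp: branch_verts_def)
    show "x = v \<or> (\<exists>w \<in> nbrs G v - {u}. x \<in> branch_verts v w)"
    proof (cases p)
      case Nil
      with p show ?thesis by (auto simp: nb_walk_def awalk_Cons_iff awalk_Nil_iff)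
    next
      case (Cons e q)
      moreover from this p have "e = (v, snd e)" "snd e \<in> nbrs G v - {u}"
        by (auto simp: nb_walk_def awalk_Cons_iff nbrs_def)
      moreover from p Cons have "nb_walk v (e # q) x"
        by (auto simp: nb_walk_def awalk_Cons_iff)
      ultimately show ?thesis
        unfolding branch_verts_def by (metis (mono_tags, lifting) mem_Collect_eq)
    qed
  next
    assume "x = v \<or> (\<exists>w \<in> nbrs G v - {u}. x \<in> branch_verts v w)"
    then show "x \<in> branch_verts u v"
    proof (elim disjE bexE)
      assume "x = v"
      then have "nb_walk u [(u, v)] x"
        using arc_implies_awalk[OF assms] by (simp add: nb_walk_def)
      then show ?thesis by (auto simp: branch_verts_def)
    next
      fix w assume w: "w \<in> nbrs G v - {u}" "x \<in> branch_verts v w"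
      then obtain p where "nb_walk v ((v, w) # p) x"
        by (auto simp: branch_verts_def)
      then have "nb_walk u ((u, v) # (v, w) # p) x"
        using w assms by (auto simp: nb_walk_def awalk_Cons_iff dest: in_arcsD1)
      then show ?thesis by (auto simp: branch_verts_def)
    qed
  qed
  then show ?thesis by auto
qed

lemma pverts_eq_branch_verts:
  assumes "r \<in> pverts G"
  shows "pverts G = insert r (\<Union>w \<in> nbrs G r. branch_verts r w)"
proof
  show "insert r (\<Union>w \<in> nbrs G r. branch_verts r w) \<subseteq> pverts G"
    using assms branch_verts_subset by auto
  show "pverts G \<subseteq> insert r (\<Union>w \<in> nbrs G r. branch_verts r w)"
  proof
    fix x assume "x \<in> pverts G"
    moreover have "strongly_connected (with_proj G)"
      using symmetric_connected_imp_strongly_connected sym_arcs connected by blast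
    ultimately have "r \<rightarrow>\<^sup>*\<^bsub>with_proj G\<^esub> x"
      using assms by (auto simp: strongly_connected_def)
    then obtain p where "apath r p x"
      using reachable_apath by blast
    then have p: "awalk r p x" "distinct (pawalk_verts r p)"
      by (auto simp: apath_def)
    \<comment> \<open>An immediate reversal would revisit a vertex, so paths do not backtrack. The
      path to \<open>x\<close> is then sorted by its first arc.\<close>
    have "awalk u p v \<Longrightarrow> distinct (pawalk_verts u p)
      \<Longrightarrow> successively (\<lambda>a b. snd b \<noteq> fst a) p" for u p v
    proof (induction p arbitrary: u)
      case (Cons e p)
      then show ?case
        by (cases p) (auto simp: awalk_Cons_iff dest: hd_in_awalk_verts)
    qed simp
    with p have "nb_walk r p x"
      by (auto simp: nb_walk_def)
    then show "x \<in> insert r (\<Union>w \<in> nbrs G r. branch_verts r w)"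
    proof (cases p)
      case Nil
      with p show ?thesis by (simp add: awalk_Nil_iff)
    next
      case (Cons e q)
      with p have "e = (r, snd e)" "snd e \<in> nbrs G r"
        by (auto simp: awalk_Cons_iff nbrs_def)
      with \<open>nb_walk r p x\<close> Cons show ?thesis
        unfolding branch_verts_def by (metis (mono_tags, lifting) UN_iff insertI2 mem_Collect_eq)
    qed
  qed
qed

text \<open>The branches are disjoint and avoid \<open>v\<close>, so their sizes add up and
  \<open>v\<close> contributes one more, matching the recursion of \<open>order\<close>.\<close>

lemma card_UN_branch_verts:
  assumes "list_all2 (\<lambda>w t. order t = card (branch_verts v w)) ws ts" "distinct ws"
  shows "card (insert v (\<Union>w \<in> set ws. branch_verts v w)) = order (Node ts)"
proof -
  have "card (\<Union>w \<in> set ws. branch_verts v w) = sum_list (map order ts)"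
    using assms
  proof (induction rule: list_all2_induct)
    case (Cons w ws t ts)
    have "branch_verts v w \<inter> branch_verts v w' = {}" if "w' \<in> set ws" for w'
      using that Cons.prems by (intro branch_verts_disjoint) auto
    then have "branch_verts v w \<inter> (\<Union>w \<in> set ws. branch_verts v w) = {}"
      by auto
    with Cons show ?case
      by (simp add: card_Un_disjoint)
  qed simp
  then show ?thesis
    by (simp add: root_notin_branch_verts)
qed

lemma order_branch:
  assumes "branch G rot u v t" "(u, v) \<in> parcs G"
  shows "order t = card (branch_verts u v)"
  using assms
proof (induction rule: branch.induct)
  case (1 v u ts)
  have vu: "(v, u) \<in> parcs G"
    using arcs_symmetric 1 by blast
  let ?ws = "map (\<lambda>i. (rot v ^^ i) u) [1..<card (nbrs G v)]"
  \<comment> \<open>The full enumeration of the neighbours starts with \<open>u\<close> and has no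
    repetitions, so dropping its head removes exactly \<open>u\<close>.\<close>
  have "distinct ?ws" "set ?ws = nbrs G v - {u}"
    using rot_enum(1,2)[OF vu] unfolding rot_enum_Cons[OF vu] distinct.simps list.set by blast+
  moreover have "list_all2 (\<lambda>w t. order t = card (branch_verts v w)) ?ws ts"
    using 1(1)
  proof (rule list.rel_mono_strong)
    fix w t
    assume "w \<in> set ?ws"
      "branch G rot v w t \<and> ((v, w) \<in> parcs G \<longrightarrow> order t = card (branch_verts v w))"
    then show "order t = card (branch_verts v w)"
      using rot_funpow_nbrs(1)[OF vu] by auto
  qed
  ultimately show ?case
    using card_UN_branch_verts[of v ?ws ts] branch_verts_rec[OF 1(2)] by metis
qed

text \<open>This turns the evenness of the number of vertices of \<open>G\<close> into the
  hypothesis of \<open>even_prtree_shift_root\<close>.\<close>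

lemma order_pr_tree_of:
  assumes "pr_tree_of G rot r m t"
  shows "order t = card (pverts G)"
proof -
  let ?ws = "map (\<lambda>i. (rot r ^^ i) m) [0..<card (nbrs G r)]"
  have rm: "(r, m) \<in> parcs G"
    using assms by (simp add: pr_tree_of_def)
  obtain ts where t: "t = Node ts" and "list_all2 (branch G rot r) ?ws ts"
    using assms by (auto simp: pr_tree_of_def)
  then have "list_all2 (\<lambda>w t. order t = card (branch_verts r w)) ?ws ts"
    using rot_funpow_nbrs(1)[OF rm] order_branch by (auto simp: list_all2_conv_all_nth)
  then show ?thesis
    using card_UN_branch_verts[of r ?ws ts] rot_enum(1,2)[OF rm]
      pverts_eq_branch_verts[OF in_arcsD1[OF rm]] t by metis
qed


section \<open>Moving the root\<close>

lemma even_prtree_adjacent: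
  assumes "even (card (pverts G))"
    and "pr_tree_of G rot r r' t" "pr_tree_of G rot r' r t'"
  shows "even_prtree t \<longleftrightarrow> even_prtree t'"
proof -
  have rr': "(r, r') \<in> parcs G" "(r', r) \<in> parcs G"
    using assms by (auto simp: pr_tree_of_def)
  obtain a ts where t: "t = Node (a # ts)" and a: "branch G rot r r' a"
    and ts: "list_all2 (branch G rot r) (map (\<lambda>i. (rot r ^^ i) r') [1..<card (nbrs G r)]) ts"
    using assms(2) unfolding pr_tree_of_def rot_enum_Cons[OF rr'(1)]
    by (auto simp: list_all2_Cons1)
  obtain ss where ss: "a = Node ss"
    "list_all2 (branch G rot r') (map (\<lambda>i. (rot r' ^^ i) r) [1..<card (nbrs G r')]) ss"
    using a by (auto elim: branch.cases)
  \<comment> \<open>The subtrees \<open>ts\<close> of \<open>r\<close> besides \<open>r'\<close> are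
    its children once \<open>r'\<close> is its parent, so \<open>Node ts\<close> is the branch at
    \<open>r\<close>; the subtrees \<open>ss\<close> follow it around the new root.\<close>
  have "pr_tree_of G rot r' r (Node (Node ts # ss))"
    unfolding pr_tree_of_def rot_enum_Cons[OF rr'(2)]
    using rr' ss ts by (auto intro: branch.intros)
  then have "t' = Node (Node ts # ss)"
    using assms(3) pr_tree_of_ex1[OF rr'(2)] by blast
  moreover have "even (order (Node (Node ss # ts)))"
    using order_pr_tree_of[OF assms(2)] assms(1) t ss(1) by simp
  ultimately show ?thesis
    using even_prtree_shift_root t ss(1) by simp
qed

text \<open>For each arc from \<open>r\<close> to \<open>u\<close>, the mark at \<open>r\<close> is
  first moved to \<open>u\<close>; then the root moves to \<open>u\<close> with the mark pointing
  back to \<open>r\<close>.\<close>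

lemma even_prtree_awalk:
  assumes "even (card (pverts G))" "awalk r p r'"
    and "pr_tree_of G rot r m t" "pr_tree_of G rot r' m' t'"
  shows "even_prtree t \<longleftrightarrow> even_prtree t'"
  using assms(2,3)
proof (induction p arbitrary: r m t)
  case Nil
  then have "pr_tree_of G rot r' m t"
    by (simp add: awalk_Nil_iff)
  then show ?case
    using assms(4) by (rule even_prtree_marked_edge)
next
  case (Cons e p)
  then obtain u where u: "e = (r, u)" "(r, u) \<in> parcs G" "awalk u p r'"
    by (cases e) (auto simp: awalk_Cons_iff)
  then have ur: "(u, r) \<in> parcs G"
    using arcs_symmetric by blast
  obtain s where s: "pr_tree_of G rot r u s"
    using pr_tree_of_ex1[OF u(2)] by blast
  obtain s' where s': "pr_tree_of G rot u r s'"
    using pr_tree_of_ex1[OF ur] by blast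
  show ?case
    using Cons.IH[OF u(3) s'] even_prtree_adjacent[OF assms(1) s s']
      even_prtree_marked_edge[OF Cons.prems(2) s] by blast
qed

end

theorem proposition2p2:
  fixes G :: "'a pair_pre_digraph" and rot :: "'a \<Rightarrow> 'a \<Rightarrow> 'a"
  assumes "plane_tree G rot"
    and "even (card (pverts G))"
    and "pr_tree_of G rot r m t"
    and "pr_tree_of G rot r' m' t'"
  shows "even_prtree t \<longleftrightarrow> even_prtree t'"
proof -
  interpret plane_tree G rot by fact
  have "r \<in> pverts G" "r' \<in> pverts G"
    using assms(3,4) in_arcsD1 by (auto simp: pr_tree_of_def)
  \<comment> \<open>Either \<open>r'\<close> is \<open>r\<close>, with the empty walk, or it lies in
    a branch at \<open>r\<close>, whose defining walk serves.\<close>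
  then obtain p where "awalk r p r'"
    using pverts_eq_branch_verts[of r]
    by (auto simp: branch_verts_def nb_walk_def intro: awalk_Nil_iff[THEN iffD2])
  then show ?thesis
    using even_prtree_awalk assms(2-4) by blast
qed

end
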